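(* Let $g(z)=\sum_{n=0}^\infty b_nz^n$ be analytic in the unit disc $\mathbb{D}$ with $b_n\ge0$ for all $n\in\mathbb{N}\cup\{0\}$. Suppose that $0<\alpha<1$ and $\beta>0$. Then the following statements are equivalent: (1) The operator $\mathcal{H}_g:H^\infty_\alpha\to H^\infty_\beta$ is bounded. (2) $g\in\mathcal{B}^{1+\beta-\alpha}$. (3) $\displaystyle\sum_{n=1}^N nb_n=O\left(N^{1+\beta-\alpha}\right)$ as $N\to\infty$.
   Context: $\mathbb{D}$ is the open unit disc of $\mathbb{C}$ and $H(\mathbb{D})$ is the space of all analytic functions in $\mathbb{D}$. For $g\in H(\mathbb{D})$ the generalized Hilbert operator is $\mathcal{H}_g(f)(z)=\int_0^1 f(t)g'(tz)\,dt$, $z\in\mathbb{D}$, for $f\in H(\mathbb{D})$ with $\int_0^1|f(t)|\,dt<\infty$ (this holds for all $f\in H^\infty_\alpha$ when $0<\alpha<1$). For $\gamma>0$, the Korenblum space $H^\infty_\gamma$ is the space of $f\in H(\mathbb{D})$ with $\|f\|_{H^\infty_\gamma}=\sup_{z\in\mathbb{D}}(1-|z|^2)^\gamma|f(z)|<\infty$, and the Bloch type space $\mathcal{B}^\gamma$ is the space of $f\in H(\mathbb{D})$ with $\|f\|_{\mathcal{B}^\gamma}=|f(0)|+\sup_{z\in\mathbb{D}}(1-|z|^2)^\gamma|f'(z)|<\infty$. *)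

theory Defs
  imports "HOL-Complex_Analysis.Complex_Analysis" "HOL-Library.Landau_Symbols"
begin

text \<open>
  Functions on the unit disc are represented by total functions \<open>complex \<Rightarrow> complex\<close>; all notions
  below depend only on their values in \<open>ball 0 1\<close>.  The norms take values in \<^typ>\<open>ennreal\<close>, so
  that they are meaningful (possibly infinite) for every analytic function, and the spaces consist
  of the analytic functions of finite norm.
\<close>

definition korenblum_norm :: "real \<Rightarrow> (complex \<Rightarrow> complex) \<Rightarrow> ennreal" where
  "korenblum_norm \<gamma> f = (SUP z\<in>ball 0 1. ennreal ((1 - (cmod z)\<^sup>2) powr \<gamma> * cmod (f z)))"

definition korenblum_space :: "real \<Rightarrow> (complex \<Rightarrow> complex) set" where
  "korenblum_space \<gamma> = {f. f holomorphic_on ball 0 1 \<and> korenblum_norm \<gamma> f < \<infinity>}"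

definition bloch_norm :: "real \<Rightarrow> (complex \<Rightarrow> complex) \<Rightarrow> ennreal" where
  "bloch_norm \<gamma> f = ennreal (cmod (f 0)) +
     (SUP z\<in>ball 0 1. ennreal ((1 - (cmod z)\<^sup>2) powr \<gamma> * cmod (deriv f z)))"

definition bloch_space :: "real \<Rightarrow> (complex \<Rightarrow> complex) set" where
  "bloch_space \<gamma> = {f. f holomorphic_on ball 0 1 \<and> bloch_norm \<gamma> f < \<infinity>}"

text \<open>
  The integral is a Lebesgue integral over the part of the unit interval lying in the disc.  For
  \<open>f\<close> analytic in the disc with \<open>\<integral>\<^sub>0\<^sup>1 |f(t)| dt < \<infinity>\<close> (in particular for \<open>f\<close> in
  \<open>korenblum_space \<alpha>\<close> with \<open>0 < \<alpha> < 1\<close>) and \<open>z\<close> in the disc, the integrand is integrable.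
\<close>

definition generalized_hilbert ::
    "(complex \<Rightarrow> complex) \<Rightarrow> (complex \<Rightarrow> complex) \<Rightarrow> complex \<Rightarrow> complex" where
  "generalized_hilbert g f z =
     (LINT t:{0..<1}|lborel. f (complex_of_real t) * deriv g (complex_of_real t * z))"

text \<open>Only used for the operators above, whose linearity is clear and not part of the predicate.\<close>

definition bounded_korenblum_operator ::
    "real \<Rightarrow> real \<Rightarrow> ((complex \<Rightarrow> complex) \<Rightarrow> complex \<Rightarrow> complex) \<Rightarrow> bool" where
  "bounded_korenblum_operator \<alpha> \<beta> T \<longleftrightarrow>
     (\<forall>f\<in>korenblum_space \<alpha>. T f \<in> korenblum_space \<beta>) \<and>
     (\<exists>C::real. \<forall>f\<in>korenblum_space \<alpha>. korenblum_norm \<beta> (T f) \<le> ennreal C * korenblum_norm \<alpha> f)"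

end

(* With h = g', the power series of h has nonnegative coefficients c n = (n + 1) b (n + 1), so |h z| <= h |z|
   and each condition is equivalent to the radial growth bound h r = O((1 - r) powr -(1 + \<beta> - \<alpha>)).
   For the partial sums, one direction evaluates h at r = N/(N + 1), and the other multiplies the
   series of h by the geometric series, which turns its coefficients into their partial sums.
   For the operator, sufficiency is a Forelli-Rudin estimate of the integral, and necessity comes from
   the single test function (1 - z) powr -\<alpha>, by restricting the integral to [sqrt r, 1). *)

theory Submission
  imports Defs
begin

section \<open>Integrals of powers of 1 - t on the unit interval\<close>

lemma has_bochner_integral_one_minus_powr:
  fixes a \<alpha> :: real
  assumes "\<alpha> < 1" "a \<le> 1"
  shows "has_bochner_integral lborel (\<lambda>t. indicator {a..<1} t *\<^sub>R (1 - t) powr (-\<alpha>))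
           ((1 - a) powr (1 - \<alpha>) / (1 - \<alpha>))"
proof -
  let ?f = "\<lambda>x::real. indicator {0..1-a} x *\<^sub>R x powr (-\<alpha>)"
  have "((\<lambda>x. x powr (-\<alpha>)) has_integral ((1 - a) powr (-\<alpha> + 1) / (-\<alpha> + 1))) {0..1-a}"
    using assms by (intro has_integral_powr_from_0) auto
  then have "(?f has_integral ((1 - a) powr (1 - \<alpha>) / (1 - \<alpha>))) UNIV"
    unfolding indicator_def of_bool_def if_distrib[where f="\<lambda>x. x *\<^sub>R a" for a]
    by (simp add: add.commute cong del: if_weak_cong del: atLeastAtMost_iff)
  then have "integral\<^sup>N lborel ?f = ennreal ((1 - a) powr (1 - \<alpha>) / (1 - \<alpha>))"
    by (intro nn_integral_has_integral_lborel) auto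
  then have "has_bochner_integral lborel ?f ((1 - a) powr (1 - \<alpha>) / (1 - \<alpha>))"
    using assms by (intro has_bochner_integral_nn_integral) auto
  then have "has_bochner_integral lborel (\<lambda>x. ?f (1 + (-1) * x))
      (((1 - a) powr (1 - \<alpha>) / (1 - \<alpha>)) /\<^sub>R \<bar>-1\<bar>)"
    by (subst (asm) lborel_has_bochner_integral_real_affine_iff[where c="-1" and t=1]) auto
  moreover have "(\<lambda>x. ?f (1 + (-1) * x)) = (\<lambda>t. indicator {a..<1} t *\<^sub>R (1 - t) powr (-\<alpha>))"
  proof
    fix x :: real
    show "?f (1 + (-1) * x) = indicator {a..<1} x *\<^sub>R (1 - x) powr (-\<alpha>)"
      \<comment> \<open>The reflection gives the closed interval \<open>{a..1}\<close>; its extra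
        point x = 1 contributes nothing because \<open>0 powr (-\<alpha>) = 0\<close>.\<close>
      by (cases "x = 1") (auto simp: indicator_def)
  qed
  ultimately show ?thesis by simp
qed

lemma set_integrable_one_minus_powr:
  fixes a \<alpha> :: real
  assumes "\<alpha> < 1" "a \<le> 1"
  shows "set_integrable lborel {a..<1} (\<lambda>t. (1 - t) powr (-\<alpha>))"
  using has_bochner_integral_one_minus_powr[OF assms]
  by (simp add: has_bochner_integral_iff set_integrable_def)

text \<open>The power -1 - \<beta> is too singular at 1 to integrate up to it, so the integral stops
  at r, where the antiderivative \<open>(1 - t) powr (-\<beta>) / \<beta>\<close> is finite.\<close>

lemma has_bochner_integral_one_minus_powr_away:
  fixes \<beta> r :: real
  assumes "0 < \<beta>" "0 \<le> r" "r < 1"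
  shows "has_bochner_integral lborel (\<lambda>t. (1 - t) powr (-1-\<beta>) * indicator {0..r} t)
           ((1 - r) powr (-\<beta>) / \<beta> - 1 / \<beta>)"
proof -
  have "has_bochner_integral lborel (\<lambda>t. (1 - t) powr (-1-\<beta>) * indicator {0..r} t)
          ((1 - r) powr (-\<beta>) / \<beta> - (1 - 0) powr (-\<beta>) / \<beta>)"
  proof (rule has_bochner_integral_FTC_Icc_nonneg)
    fix x assume "x \<in> {0..r}"
    then have "0 < 1 - x" using assms by auto
    then have "((\<lambda>x. (1 - x) powr (-\<beta>)) has_real_derivative (- \<beta>) * (1 - x) powr (-\<beta> - 1) * (-1)) (at x)"
      by (auto intro!: derivative_eq_intros simp: powr_diff field_simps)
    then have "((\<lambda>x. (1 - x) powr (-\<beta>) / \<beta>) has_real_derivative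
        ((- \<beta>) * (1 - x) powr (-\<beta> - 1) * (-1)) / \<beta>) (at x)"
      by (rule DERIV_cdivide)
    moreover have "-\<beta> - 1 = -1 - \<beta>" by simp
    ultimately show "((\<lambda>x. (1 - x) powr (-\<beta>) / \<beta>) has_real_derivative (1 - x) powr (-1-\<beta>)) (at x)"
      using assms by simp
  qed (use assms in auto)
  then show ?thesis by simp
qed

text \<open>The integral is split at \<open>t = r\<close>, where
  the two lower bounds \<open>1 - t\<close> and \<open>1 - r\<close> of \<open>1 - r t\<close> agree.\<close>

lemma set_integral_forelli_rudin:
  fixes \<alpha> \<beta> r :: real
  assumes "\<alpha> < 1" "0 < \<beta>" "0 \<le> r" "r < 1"
  defines "k \<equiv> \<lambda>t. (1 - t) powr (-\<alpha>) * (1 - r * t) powr (-(1 + \<beta> - \<alpha>))"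
  shows "set_integrable lborel {0..<1} k"
    and "(LINT t:{0..<1}|lborel. k t) \<le> (1 / (1 - \<alpha>) + 1 / \<beta>) * (1 - r) powr (-\<beta>)"
proof -
  let ?\<gamma> = "1 + \<beta> - \<alpha>"
  let ?k1 = "\<lambda>t. indicator {r..<1} t *\<^sub>R (1 - t) powr (-\<alpha>)"
  let ?k2 = "\<lambda>t. (1 - t) powr (-1-\<beta>) * indicator {0..r} t"
  \<comment> \<open>Both pieces are present at t = r; this overlap is harmless because
    \<open>?K\<close> only serves as an upper bound.\<close>
  let ?K = "\<lambda>t. (1 - r) powr (-?\<gamma>) * ?k1 t + ?k2 t"
  let ?I = "(1 - r) powr (-?\<gamma>) * ((1 - r) powr (1 - \<alpha>) / (1 - \<alpha>)) + ((1 - r) powr (-\<beta>) / \<beta> - 1 / \<beta>)"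
  have K: "has_bochner_integral lborel ?K ?I"
    using assms by (intro has_bochner_integral_add has_bochner_integral_mult_right
        has_bochner_integral_one_minus_powr has_bochner_integral_one_minus_powr_away) auto
  have nonneg: "k t \<ge> 0" for t by (simp add: k_def)
  have le: "indicator {0..<1} t *\<^sub>R k t \<le> ?K t" for t
  proof (cases "t \<in> {0..<1}")
    case True
    then have t: "0 \<le> t" "t < 1" by auto
    have rt: "r * t \<le> t" "r * t \<le> r"
      using t assms mult_left_le_one_le[of t r] mult_left_le[of t r] by (auto simp: mult.commute)
    show ?thesis
    proof (cases "r \<le> t")
      case 1: True
      have "(1 - r * t) powr (-?\<gamma>) \<le> (1 - r) powr (-?\<gamma>)"
        using rt assms by (intro powr_mono2') auto
      then have "k t \<le> (1 - r) powr (-?\<gamma>) * (1 - t) powr (-\<alpha>)"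
        unfolding k_def by (subst mult.commute) (intro mult_right_mono, auto)
      also have "(1 - t) powr (-\<alpha>) = ?k1 t" using 1 t by (simp add: indicator_def)
      also have "(1 - r) powr (-?\<gamma>) * ?k1 t \<le> ?K t"
        by (simp only: le_add_same_cancel1) simp
      finally show ?thesis using True by simp
    next
      case 2: False
      have "(1 - r * t) powr (-?\<gamma>) \<le> (1 - t) powr (-?\<gamma>)"
        using rt assms t by (intro powr_mono2') auto
      then have "k t \<le> (1 - t) powr (-\<alpha>) * (1 - t) powr (-?\<gamma>)"
        unfolding k_def by (intro mult_left_mono) auto
      also have "\<dots> = (1 - t) powr (-1-\<beta>)"
        by (simp add: powr_add[symmetric])
      finally show ?thesis using True 2 t by (simp add: indicator_def)
    qed
  next
    case False
    then have "indicator {0..<1} t *\<^sub>R k t = 0" by (simp add: indicator_def)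
    also have "0 \<le> ?K t" by simp
    finally show ?thesis .
  qed
  have "integrable lborel (\<lambda>t. indicator {0..<1} t *\<^sub>R k t)"
  proof (rule Bochner_Integration.integrable_bound)
    show "integrable lborel ?K" using K by (simp add: has_bochner_integral_iff)
    show "(\<lambda>t. indicator {0..<1} t *\<^sub>R k t) \<in> borel_measurable lborel"
      unfolding k_def by measurable
    show "AE t in lborel. norm (indicator {0..<1} t *\<^sub>R k t) \<le> norm (?K t)"
      using le nonneg by (intro AE_I2) (smt (verit) real_norm_def indicator_pos_le scaleR_nonneg_nonneg)
  qed
  then show int: "set_integrable lborel {0..<1} k" by (simp add: set_integrable_def)
  have "(LINT t:{0..<1}|lborel. k t) \<le> integral\<^sup>L lborel ?K"
    unfolding set_lebesgue_integral_def
    using int K le by (intro integral_mono) (auto simp: set_integrable_def has_bochner_integral_iff)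
  also have "\<dots> = ?I" using K by (simp add: has_bochner_integral_iff)
  \<comment> \<open>The exponents -(1 + \<beta> - \<alpha>) and 1 - \<alpha> add up to -\<beta>, so
    both pieces have the same order; the term -1/\<beta> is dropped.\<close>
  also have "\<dots> \<le> (1 / (1 - \<alpha>) + 1 / \<beta>) * (1 - r) powr (-\<beta>)"
    using assms by (simp add: powr_add[symmetric] ring_distribs)
  finally show "(LINT t:{0..<1}|lborel. k t) \<le> (1 / (1 - \<alpha>) + 1 / \<beta>) * (1 - r) powr (-\<beta>)" .
qed

section \<open>Korenblum and Bloch norms as pointwise growth bounds\<close>

text \<open>Follows from 1 - x^2 = (1 + x)(1 - x) with 1 \<le> 1 + x \<le> 2. It allows the weight
  in the norms to be replaced by a power of 1 - |z|, at the cost of a factor 2^\<gamma>.\<close>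

lemma one_minus_square_powr_bounds:
  fixes x \<gamma> :: real
  assumes "0 \<le> x" "x < 1" "0 < \<gamma>"
  shows "(1 - x) powr \<gamma> \<le> (1 - x\<^sup>2) powr \<gamma>" "(1 - x\<^sup>2) powr \<gamma> \<le> 2 powr \<gamma> * (1 - x) powr \<gamma>"
proof -
  have eq: "1 - x\<^sup>2 = (1 + x) * (1 - x)" by (simp add: power2_eq_square algebra_simps)
  have "1 * (1 - x) \<le> (1 + x) * (1 - x)" "(1 + x) * (1 - x) \<le> 2 * (1 - x)"
    using assms by (intro mult_right_mono; simp)+
  then have *: "1 - x \<le> 1 - x\<^sup>2" "1 - x\<^sup>2 \<le> 2 * (1 - x)" by (simp_all add: eq)
  show "(1 - x) powr \<gamma> \<le> (1 - x\<^sup>2) powr \<gamma>"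
    using * assms by (intro powr_mono2) auto
  have "(1 - x\<^sup>2) powr \<gamma> \<le> (2 * (1 - x)) powr \<gamma>"
    using * assms by (intro powr_mono2) auto
  then show "(1 - x\<^sup>2) powr \<gamma> \<le> 2 powr \<gamma> * (1 - x) powr \<gamma>"
    using assms powr_mult[of 2 "1 - x" \<gamma>] by simp
qed

lemma cmod_le_korenblum_norm:
  assumes "korenblum_norm \<gamma> f < \<infinity>" "0 < \<gamma>" "z \<in> ball 0 1"
  shows "cmod (f z) \<le> enn2real (korenblum_norm \<gamma> f) * (1 - cmod z) powr (-\<gamma>)"
proof -
  have z: "cmod z < 1" using assms by simp
  have "ennreal ((1 - (cmod z)\<^sup>2) powr \<gamma> * cmod (f z)) \<le> korenblum_norm \<gamma> f"
    unfolding korenblum_norm_def using assms by (intro SUP_upper)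
  then have "(1 - (cmod z)\<^sup>2) powr \<gamma> * cmod (f z) \<le> enn2real (korenblum_norm \<gamma> f)"
    \<comment> \<open>Finiteness of the norm matters here: \<open>enn2real\<close> sends infinity to
      0.\<close>
    using assms by (metis enn2real_ennreal enn2real_mono mult_nonneg_nonneg norm_ge_zero powr_ge_zero infinity_ennreal_def)
  moreover have "(1 - cmod z) powr \<gamma> * cmod (f z) \<le> (1 - (cmod z)\<^sup>2) powr \<gamma> * cmod (f z)"
    using one_minus_square_powr_bounds(1) z assms by (intro mult_right_mono) auto
  ultimately have "(1 - cmod z) powr \<gamma> * cmod (f z) \<le> enn2real (korenblum_norm \<gamma> f)" by linarith
  moreover have "0 < (1 - cmod z) powr \<gamma>" using z by simp
  ultimately show ?thesis by (simp add: powr_minus field_simps)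
qed

lemma korenblum_norm_le:
  assumes "\<And>z. z \<in> ball 0 1 \<Longrightarrow> cmod (f z) \<le> B * (1 - cmod z) powr (-\<gamma>)" "0 < \<gamma>" "0 \<le> B"
  shows "korenblum_norm \<gamma> f \<le> ennreal (2 powr \<gamma> * B)"
  unfolding korenblum_norm_def
proof (intro SUP_least ennreal_leI)
  fix z :: complex assume z: "z \<in> ball 0 1"
  then have z': "cmod z < 1" by simp
  have "(1 - (cmod z)\<^sup>2) powr \<gamma> * cmod (f z)
      \<le> (2 powr \<gamma> * (1 - cmod z) powr \<gamma>) * (B * (1 - cmod z) powr (-\<gamma>))"
    using one_minus_square_powr_bounds(2)[of "cmod z" \<gamma>] z z' assms by (intro mult_mono) auto
  also have "\<dots> = 2 powr \<gamma> * B * ((1 - cmod z) powr \<gamma> * (1 - cmod z) powr (-\<gamma>))"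
    by (simp only: mult_ac)
  also have "(1 - cmod z) powr \<gamma> * (1 - cmod z) powr (-\<gamma>) = 1"
    using z' by (simp add: powr_add[symmetric])
  finally show "(1 - (cmod z)\<^sup>2) powr \<gamma> * cmod (f z) \<le> 2 powr \<gamma> * B" by simp
qed

text \<open>Turns finiteness of a supremum in \<open>ennreal\<close> into a real pointwise majorant,
  the form used for \<open>h\<close>, for the test function and for its image under the
  operator.\<close>

lemma korenblum_norm_finite_iff:
  assumes "0 < \<gamma>"
  shows "korenblum_norm \<gamma> f < \<infinity> \<longleftrightarrow>
    (\<exists>B\<ge>0. \<forall>z\<in>ball 0 1. cmod (f z) \<le> B * (1 - cmod z) powr (-\<gamma>))"
proof
  assume "korenblum_norm \<gamma> f < \<infinity>"
  then show "\<exists>B\<ge>0. \<forall>z\<in>ball 0 1. cmod (f z) \<le> B * (1 - cmod z) powr (-\<gamma>)"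
    using cmod_le_korenblum_norm[of \<gamma> f] assms
    by (intro exI[of _ "enn2real (korenblum_norm \<gamma> f)"]) auto
next
  assume "\<exists>B\<ge>0. \<forall>z\<in>ball 0 1. cmod (f z) \<le> B * (1 - cmod z) powr (-\<gamma>)"
  then obtain B where "korenblum_norm \<gamma> f \<le> ennreal (2 powr \<gamma> * B)"
    using korenblum_norm_le assms by metis
  then show "korenblum_norm \<gamma> f < \<infinity>"
    by (metis ennreal_less_top infinity_ennreal_def order_le_less_trans)
qed

text \<open>The summand |g(0)| is always finite, so only the supremum over the derivative decides
  membership.\<close>

lemma bloch_space_iff_korenblum_norm_deriv:
  assumes "g holomorphic_on ball 0 1"
  shows "g \<in> bloch_space \<gamma> \<longleftrightarrow> korenblum_norm \<gamma> (deriv g) < \<infinity>"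
proof -
  have "bloch_norm \<gamma> g = ennreal (cmod (g 0)) + korenblum_norm \<gamma> (deriv g)"
    by (simp add: bloch_norm_def korenblum_norm_def)
  then show ?thesis using assms by (simp add: bloch_space_def)
qed

section \<open>Power series with nonnegative coefficients on the disc\<close>

text \<open>Instantiated in the end with \<open>h = deriv g\<close>. All three conditions of the
  theorem are compared with the growth of \<open>h\<close> on [0, 1).\<close>

locale nonneg_power_series =
  fixes c :: "nat \<Rightarrow> real" and h :: "complex \<Rightarrow> complex"
  assumes nonneg: "\<And>n. c n \<ge> 0"
    and sums: "\<And>z. z \<in> ball 0 1 \<Longrightarrow> (\<lambda>n. complex_of_real (c n) * z ^ n) sums h z"
begin

lemma sums_real:
  assumes "0 \<le> r" "r < 1"
  shows "(\<lambda>n. c n * r ^ n) sums Re (h (of_real r))"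
proof -
  have "(\<lambda>n. complex_of_real (c n) * of_real r ^ n) sums h (of_real r)"
    using assms by (intro sums) auto
  from sums_Re[OF this] show ?thesis by (simp flip: of_real_power of_real_mult)
qed

lemma real_valued:
  assumes "0 \<le> r" "r < 1"
  shows "h (of_real r) = of_real (Re (h (of_real r)))"
proof -
  have "(\<lambda>n. complex_of_real (c n) * of_real r ^ n) sums h (of_real r)"
    using assms by (intro sums) auto
  moreover have "(\<lambda>n. complex_of_real (c n) * of_real r ^ n) sums of_real (Re (h (of_real r)))"
    using sums_of_real[OF sums_real[OF assms], where 'a=complex] by simp
  ultimately show ?thesis by (rule sums_unique2)
qed

lemma nonneg_real: "0 \<le> r \<Longrightarrow> r < 1 \<Longrightarrow> 0 \<le> Re (h (of_real r))"
  using sums_le[OF _ sums_zero sums_real, of r] nonneg by simp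

lemma mono_real:
  assumes "0 \<le> r" "r \<le> s" "s < 1"
  shows "Re (h (of_real r)) \<le> Re (h (of_real s))"
  using assms by (intro sums_le[OF _ sums_real sums_real] mult_left_mono power_mono nonneg) auto

text \<open>The triangle inequality applied termwise to the series: as the coefficients are
  nonnegative, the modulus on a circle is largest at its positive real point.\<close>

lemma cmod_le_radial:
  assumes "z \<in> ball 0 1"
  shows "cmod (h z) \<le> Re (h (of_real (cmod z)))"
proof -
  have "cmod z < 1" using assms by simp
  then show ?thesis
    using nonneg by (intro norm_sums_le[OF sums[OF assms] sums_real]) (simp_all add: norm_mult norm_power)
qed

lemma holomorphic: "h holomorphic_on ball 0 1"
  using sums by (intro power_series_holomorphic[of 0 1 "\<lambda>n. of_real (c n)"]) auto

text \<open>Restriction to the radius gives one direction and \<open>cmod_le_radial\<close> the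
  other, both with the same constant B.\<close>

lemma korenblum_norm_finite_iff_radial:
  assumes "0 < \<gamma>"
  shows "korenblum_norm \<gamma> h < \<infinity> \<longleftrightarrow>
    (\<exists>B\<ge>0. \<forall>r\<in>{0..<1}. Re (h (of_real r)) \<le> B * (1 - r) powr (-\<gamma>))"
  unfolding korenblum_norm_finite_iff[OF assms]
proof (intro ex_cong1 conj_cong refl iffI ballI)
  fix B r assume "\<forall>z\<in>ball 0 1. cmod (h z) \<le> B * (1 - cmod z) powr (-\<gamma>)" "r \<in> {0..<1::real}"
  then show "Re (h (of_real r)) \<le> B * (1 - r) powr (-\<gamma>)"
    using complex_Re_le_cmod[of "h (of_real r)"] by (force dest!: bspec[of _ _ "of_real r"])
next
  fix B and z :: complex
  assume "\<forall>r\<in>{0..<1}. Re (h (of_real r)) \<le> B * (1 - r) powr (-\<gamma>)" "z \<in> ball 0 1"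
  then show "cmod (h z) \<le> B * (1 - cmod z) powr (-\<gamma>)"
    using cmod_le_radial[of z] by (force dest!: bspec[of _ _ "cmod z"])
qed

section \<open>Partial sums of the coefficients versus radial growth\<close>

text \<open>With r = N/(N + 1) every n < N satisfies r^n \<ge> r^N \<ge> 1/e, so the partial sum is
  at most e h(r), while 1/(1 - r) = N + 1 \<le> 2N turns the growth bound into a power of N.\<close>

lemma partial_sums_bound:
  assumes B: "\<And>r. r \<in> {0..<1} \<Longrightarrow> Re (h (of_real r)) \<le> B * (1 - r) powr (-\<gamma>)"
    and "0 \<le> B" "0 < \<gamma>" "N \<ge> 1"
  shows "(\<Sum>n<N. c n) \<le> exp 1 * B * 2 powr \<gamma> * real N powr \<gamma>"
proof -
  define r where "r = real N / (real N + 1)"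
  have r: "0 < r" "r < 1" "1 - r = 1 / (real N + 1)"
    using assms by (auto simp: r_def field_simps)
  \<comment> \<open>The classical bound (1 + 1/N)^N \<le> e, read as a lower bound for r^N.\<close>
  have "1 / r = 1 + 1 / real N" using assms by (simp add: r_def field_simps)
  also have "\<dots> \<le> exp (1 / real N)" by (rule exp_ge_add_one_self)
  finally have "(1 / r) ^ N \<le> exp (1 / real N) ^ N"
    using r by (intro power_mono) auto
  also have "\<dots> = exp 1" using assms by (simp flip: exp_of_nat_mult)
  finally have e: "1 \<le> exp 1 * r ^ N" using r by (simp add: power_one_over field_simps)
  have pow: "(1 - r) powr (-\<gamma>) \<le> 2 powr \<gamma> * real N powr \<gamma>"
  proof -
    have "(1 - r) powr (-\<gamma>) = (real N + 1) powr \<gamma>"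
      unfolding r(3) by (simp add: powr_minus powr_divide)
    also have "\<dots> \<le> (2 * real N) powr \<gamma>" using assms by (intro powr_mono2) auto
    also have "\<dots> = 2 powr \<gamma> * real N powr \<gamma>" by (simp add: powr_mult)
    finally show ?thesis .
  qed
  have s: "(\<lambda>n. c n * r ^ n) sums Re (h (of_real r))" using r by (intro sums_real) auto
  have "(\<Sum>n<N. c n * r ^ N) \<le> (\<Sum>n<N. c n * r ^ n)"
    using r nonneg by (intro sum_mono mult_left_mono power_decreasing) auto
  also have "\<dots> \<le> Re (h (of_real r))"
    using sum_le_suminf[OF sums_summable[OF s], of "{..<N}"] nonneg r sums_unique[OF s] by simp
  also have "\<dots> \<le> B * (1 - r) powr (-\<gamma>)" using r by (intro B) auto
  also have "\<dots> \<le> B * (2 powr \<gamma> * real N powr \<gamma>)"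
    using assms pow by (intro mult_left_mono) auto
  finally have *: "(\<Sum>n<N. c n * r ^ N) \<le> B * (2 powr \<gamma> * real N powr \<gamma>)" .
  have "(\<Sum>n<N. c n) \<le> exp 1 * r ^ N * (\<Sum>n<N. c n)"
    using mult_right_mono[OF e sum_nonneg[of "{..<N}" c]] nonneg by simp
  also have "\<dots> = exp 1 * (\<Sum>n<N. c n * r ^ N)"
    by (simp add: sum_distrib_left mult_ac)
  also have "\<dots> \<le> exp 1 * (B * (2 powr \<gamma> * real N powr \<gamma>))"
    using * by (intro mult_left_mono) auto
  finally show ?thesis by (simp add: mult.assoc)
qed

end

text \<open>The inequality y \<le> e^y at y = x/\<gamma>, raised to the power \<gamma>.\<close>

lemma powr_le_exp:
  fixes x \<gamma> :: real
  assumes "0 \<le> x" "0 < \<gamma>"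
  shows "x powr \<gamma> \<le> \<gamma> powr \<gamma> * exp x"
proof -
  have "x / \<gamma> \<le> exp (x / \<gamma>)" using exp_ge_add_one_self[of "x/\<gamma>"] by linarith
  then have "(x / \<gamma>) powr \<gamma> \<le> exp (x / \<gamma>) powr \<gamma>" using assms by (intro powr_mono2) auto
  also have "\<dots> = exp x" using assms by (simp add: powr_def)
  finally show ?thesis using assms by (simp add: powr_divide field_simps)
qed

text \<open>Put x = (k + 1)(1 - q). Then q^k \<le> e^(1 - x), and this exponential decay absorbs
  x^\<gamma> by \<open>powr_le_exp\<close>, uniformly in k.\<close>

lemma powr_mult_power_le:
  fixes q \<gamma> :: real
  assumes "0 \<le> q" "q < 1" "0 < \<gamma>"
  shows "real (Suc k) powr \<gamma> * q ^ k \<le> \<gamma> powr \<gamma> * exp 1 * (1 - q) powr (-\<gamma>)"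
proof -
  have "q \<le> exp (-(1 - q))" using exp_ge_add_one_self[of "-(1-q)"] by simp
  then have "q ^ k \<le> exp (-(1 - q)) ^ k" using assms by (intro power_mono) auto
  also have "\<dots> = exp (- (real k * (1 - q)))" by (simp flip: exp_of_nat_mult add: right_diff_distrib)
  \<comment> \<open>Passing from k to k + 1 changes the exponent by 1 - q, which is at most 1; this
    is the source of the factor \<open>exp 1\<close>.\<close>
  also have "\<dots> \<le> exp (1 - real (Suc k) * (1 - q))" using assms by (simp add: algebra_simps)
  finally have 1: "q ^ k \<le> exp (1 - real (Suc k) * (1 - q))" .
  have 2: "(real (Suc k) * (1 - q)) powr \<gamma> \<le> \<gamma> powr \<gamma> * exp (real (Suc k) * (1 - q))"
    using assms by (intro powr_le_exp) auto
  have "(1 - q) powr \<gamma> * (real (Suc k) powr \<gamma> * q ^ k) = (real (Suc k) * (1 - q)) powr \<gamma> * q ^ k"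
    using assms by (simp add: powr_mult mult_ac)
  also have "\<dots> \<le> (\<gamma> powr \<gamma> * exp (real (Suc k) * (1 - q))) * exp (1 - real (Suc k) * (1 - q))"
    using assms by (intro mult_mono 1 2) auto
  also have "\<dots> = \<gamma> powr \<gamma> * exp 1" by (simp flip: exp_add add: mult.assoc)
  finally have "(1 - q) powr \<gamma> * (real (Suc k) powr \<gamma> * q ^ k) \<le> \<gamma> powr \<gamma> * exp 1" .
  moreover have "(1 - q) powr \<gamma> > 0" using assms by simp
  ultimately show ?thesis by (simp add: powr_minus field_simps)
qed

context nonneg_power_series
begin

text \<open>The Cauchy product of h(r) with the geometric series has the partial sums as
  coefficients. With q = sqrt r, split r^k = q^k q^k: one factor absorbs the growth (k +
  1)^\<gamma>, the other leaves a convergent geometric series.\<close>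

lemma radial_bound:
  assumes C: "\<And>N. N \<ge> 1 \<Longrightarrow> (\<Sum>n<N. c n) \<le> C * real N powr \<gamma>"
    and "0 < \<gamma>" "0 \<le> r" "r < 1"
  shows "Re (h (of_real r)) \<le> C * \<gamma> powr \<gamma> * exp 1 * 2 powr (\<gamma> + 1) * (1 - r) powr (-\<gamma>)"
proof -
  define q where "q = sqrt r"
  define L where "L = C * \<gamma> powr \<gamma> * exp 1"
  have C0: "0 \<le> C" using C[of 1] nonneg[of 0] by simp
  then have L0: "0 \<le> L" by (simp add: L_def)
  have q: "0 \<le> q" "q < 1" "q\<^sup>2 = r" using assms by (auto simp: q_def)
  have s: "(\<lambda>n. c n * r ^ n) sums Re (h (of_real r))" using assms by (intro sums_real) auto
  have g: "(\<lambda>n. r ^ n) sums (1 / (1 - r))" using assms by (intro geometric_sums) auto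
  have abs: "summable (\<lambda>n. norm (c n * r ^ n))" "summable (\<lambda>n. norm (r ^ n))"
    using sums_summable[OF s] sums_summable[OF g] nonneg assms by (simp_all add: abs_mult)
  \<comment> \<open>The k-th coefficient sums over i \<le> k, so the hypothesis is applied at N = k
    + 1, which is at least 1 even for k = 0.\<close>
  have eq: "(\<Sum>i\<le>k. c i * r ^ i * r ^ (k - i)) = (\<Sum>n<Suc k. c n) * r ^ k" for k
    unfolding sum_distrib_right lessThan_Suc_atMost
    by (intro sum.cong refl) (simp add: mult.assoc flip: power_add)
  have lhs: "(\<lambda>k. (\<Sum>n<Suc k. c n) * r ^ k) sums (Re (h (of_real r)) * (1 / (1 - r)))"
    using Cauchy_product_sums[OF abs] unfolding eq
    by (simp only: sums_unique[OF s, symmetric] sums_unique[OF g, symmetric])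
  have rhs: "(\<lambda>k. L * (1 - q) powr (-\<gamma>) * q ^ k) sums (L * (1 - q) powr (-\<gamma>) * (1 / (1 - q)))"
    using q by (intro sums_mult geometric_sums) auto
  have le: "(\<Sum>n<Suc k. c n) * r ^ k \<le> L * (1 - q) powr (-\<gamma>) * q ^ k" for k
  proof -
    have "(\<Sum>n<Suc k. c n) * r ^ k \<le> (C * real (Suc k) powr \<gamma>) * r ^ k"
      using assms by (intro mult_right_mono C) auto
    also have "\<dots> = C * (real (Suc k) powr \<gamma> * q ^ k) * q ^ k"
      by (simp flip: q(3) add: power2_eq_square power_mult_distrib)
    also have "\<dots> \<le> C * (\<gamma> powr \<gamma> * exp 1 * (1 - q) powr (-\<gamma>)) * q ^ k"
      using q assms C0 by (intro mult_right_mono mult_left_mono powr_mult_power_le) auto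
    finally show ?thesis by (simp add: L_def mult_ac)
  qed
  have "Re (h (of_real r)) * (1 / (1 - r)) \<le> L * (1 - q) powr (-\<gamma>) * (1 / (1 - q))"
    by (rule sums_le[OF le lhs rhs])
  also have "\<dots> = L * (1 - q) powr (-\<gamma> - 1)"
    using q by (simp add: powr_diff)
  \<comment> \<open>Back from q to r by 1 - r = (1 + q)(1 - q) \<le> 2(1 - q); the negative exponent
    reverses the inequality.\<close>
  also have "\<dots> \<le> L * ((1 - r) / 2) powr (-\<gamma> - 1)"
  proof (intro mult_left_mono powr_mono2')
    have "1 - r = (1 + q) * (1 - q)" by (simp flip: q(3) add: power2_eq_square algebra_simps)
    also have "\<dots> \<le> 2 * (1 - q)" using q by (intro mult_right_mono) auto
    finally show "(1 - r) / 2 \<le> 1 - q" by simp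
  qed (use assms L0 in auto)
  also have "((1 - r) / 2) powr (-\<gamma> - 1) = (1 - r) powr (-\<gamma>) / (1 - r) * 2 powr (\<gamma> + 1)"
    using assms powr_divide[of "1 - r" 2 "-\<gamma> - 1"] powr_diff[of "1 - r" "-\<gamma>" 1]
      powr_minus_divide[of 2 "\<gamma> + 1"] by simp
  finally have "Re (h (of_real r)) / (1 - r)
      \<le> (L * 2 powr (\<gamma>+1) * (1 - r) powr (-\<gamma>)) / (1 - r)"
    by (simp add: mult_ac)
  then show ?thesis unfolding L_def using assms by (simp add: divide_le_cancel)
qed

lemma radial_iff_partial_sums:
  assumes "0 < \<gamma>"
  shows "(\<exists>B\<ge>0. \<forall>r\<in>{0..<1}. Re (h (of_real r)) \<le> B * (1 - r) powr (-\<gamma>)) \<longleftrightarrow>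
    (\<lambda>N. \<Sum>n<N. c n) \<in> O(\<lambda>N. real N powr \<gamma>)"
proof
  assume "\<exists>B\<ge>0. \<forall>r\<in>{0..<1}. Re (h (of_real r)) \<le> B * (1 - r) powr (-\<gamma>)"
  then obtain B where B: "B \<ge> 0" "\<And>r. r \<in> {0..<1} \<Longrightarrow> Re (h (of_real r)) \<le> B * (1 - r) powr (-\<gamma>)"
    by blast
  show "(\<lambda>N. \<Sum>n<N. c n) \<in> O(\<lambda>N. real N powr \<gamma>)"
    using partial_sums_bound[OF B(2) B(1) assms] nonneg
    by (intro bigoI[of _ "exp 1 * B * 2 powr \<gamma>"] eventually_sequentiallyI[of 1])
       (auto simp: sum_nonneg)
next
  assume "(\<lambda>N. \<Sum>n<N. c n) \<in> O(\<lambda>N. real N powr \<gamma>)"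
  then obtain C where "C > 0"
    "\<forall>\<^sub>F N in sequentially. norm (\<Sum>n<N. c n) \<le> C * norm (real N powr \<gamma>)"
    by (rule landau_o.bigE)
  then obtain N0 where N0: "\<And>N. N \<ge> N0 \<Longrightarrow> (\<Sum>n<N. c n) \<le> C * real N powr \<gamma>"
    using nonneg by (auto simp: eventually_sequentially sum_nonneg)
  \<comment> \<open>The O-bound holds only from \<open>N0\<close> on. For 1 \<le> N < N0 the partial
    sum is at most the one at \<open>N0\<close>, and N^\<gamma> \<ge> 1, so \<open>D\<close> covers
    every N \<ge> 1.\<close>
  define D where "D = max C (\<Sum>n<N0. c n)"
  have D: "(\<Sum>n<N. c n) \<le> D * real N powr \<gamma>" if "N \<ge> 1" for N
  proof (cases "N \<ge> N0")
    case True
    have "C * real N powr \<gamma> \<le> D * real N powr \<gamma>"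
      by (intro mult_right_mono) (auto simp: D_def)
    then show ?thesis using N0[OF True] by linarith
  next
    case False
    have "(\<Sum>n<N. c n) \<le> (\<Sum>n<N0. c n)"
      using False nonneg by (intro sum_mono2) auto
    also have "\<dots> \<le> D * 1" by (simp add: D_def)
    also have "\<dots> \<le> D * real N powr \<gamma>"
      using that assms \<open>C > 0\<close> by (intro mult_left_mono ge_one_powr_ge_zero) (auto simp: D_def)
    finally show ?thesis .
  qed
  have "D \<ge> 0" using \<open>C > 0\<close> by (simp add: D_def)
  then show "\<exists>B\<ge>0. \<forall>r\<in>{0..<1}. Re (h (of_real r)) \<le> B * (1 - r) powr (-\<gamma>)"
    using radial_bound[OF D assms]
    by (intro exI[of _ "D * \<gamma> powr \<gamma> * exp 1 * 2 powr (\<gamma> + 1)"]) auto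
qed

end

section \<open>The integral operator: analyticity and sufficiency of the growth bound\<close>

text \<open>Parametrised by \<open>h\<close> instead of \<open>g\<close>, so that the locale can
  treat the operator through the power series of \<open>h\<close> alone.\<close>

definition hilbert_integral :: "(complex \<Rightarrow> complex) \<Rightarrow> (complex \<Rightarrow> complex) \<Rightarrow> complex \<Rightarrow> complex" where
  "hilbert_integral h f z = (LINT t:{0..<1}|lborel. f (complex_of_real t) * h (complex_of_real t * z))"

lemma set_integrable_radial:
  assumes \<phi>: "continuous_on (ball 0 1) \<phi>" and "\<alpha> < 1"
    and A: "\<And>z. z \<in> ball 0 1 \<Longrightarrow> cmod (\<phi> z) \<le> A * (1 - cmod z) powr (-\<alpha>)"
  shows "set_integrable lborel {0..<1} (\<lambda>t. \<phi> (complex_of_real t))"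
proof (rule set_integrable_bound)
  show "set_integrable lborel {0..<1} (\<lambda>t. A * (1 - t) powr (-\<alpha>))"
    using assms by (intro set_integrable_mult_right set_integrable_one_minus_powr) auto
  have "continuous_on {0..<1} (\<lambda>t. \<phi> (complex_of_real t))"
    by (intro continuous_on_compose2[OF \<phi>] continuous_intros) auto
  then show "set_borel_measurable lborel {0..<1} (\<lambda>t. \<phi> (complex_of_real t))"
    unfolding set_borel_measurable_def by (simp add: borel_measurable_continuous_on_indicator)
  show "AE t in lborel. t \<in> {0..<1} \<longrightarrow> norm (\<phi> (complex_of_real t)) \<le> norm (A * (1 - t) powr (-\<alpha>))"
  proof (intro AE_I2 impI)
    fix t :: real assume "t \<in> {0..<1}"
    then show "norm (\<phi> (complex_of_real t)) \<le> norm (A * (1 - t) powr (-\<alpha>))"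
      using A[of "of_real t"] by (auto simp: norm_mult intro: order_trans[OF _ abs_ge_self])
  qed
qed

context nonneg_power_series
begin

text \<open>For fixed z the points w z stay in the disc of radius |z|, where |h| is at most h(|z|).
  Hence f(w) h(w z) inherits the growth of f, with constant A h(|z|).\<close>

lemma set_integrable_hilbert_integrand:
  assumes f: "continuous_on (ball 0 1) f" and "\<alpha> < 1" "0 \<le> A"
    and A: "\<And>z. z \<in> ball 0 1 \<Longrightarrow> cmod (f z) \<le> A * (1 - cmod z) powr (-\<alpha>)"
    and z: "z \<in> ball 0 1"
  shows "set_integrable lborel {0..<1} (\<lambda>t. f (complex_of_real t) * h (complex_of_real t * z))"
proof -
  have in_ball: "w * z \<in> ball 0 1" and le: "cmod (w * z) \<le> cmod z" if "w \<in> ball 0 1" for w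
  proof -
    show "cmod (w * z) \<le> cmod z"
      using that by (auto simp: norm_mult intro: mult_left_le_one_le)
    then show "w * z \<in> ball 0 1" using z by simp
  qed
  show ?thesis
  proof (rule set_integrable_radial[where \<phi> = "\<lambda>w. f w * h (w * z)"])
    show "continuous_on (ball 0 1) (\<lambda>w. f w * h (w * z))"
      using in_ball
      by (intro continuous_intros f continuous_on_compose2[OF holomorphic_on_imp_continuous_on[OF holomorphic]]) auto
    fix w :: complex assume w: "w \<in> ball 0 1"
    have "cmod (h (w * z)) \<le> Re (h (of_real (cmod (w * z))))"
      by (rule cmod_le_radial[OF in_ball[OF w]])
    also have "\<dots> \<le> Re (h (of_real (cmod z)))"
      using le[OF w] z by (intro mono_real) auto
    finally have "cmod (f w) * cmod (h (w * z)) \<le> (A * (1 - cmod w) powr (-\<alpha>)) * Re (h (of_real (cmod z)))"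
      using A[OF w] \<open>0 \<le> A\<close> by (intro mult_mono) auto
    then show "cmod (f w * h (w * z)) \<le> (A * Re (h (of_real (cmod z)))) * (1 - cmod w) powr (-\<alpha>)"
      by (simp add: norm_mult mult_ac)
  qed fact
qed

text \<open>Integrating the power series of \<open>h\<close> termwise exhibits \<open>hilbert_integral h f\<close> as a power
  series whose coefficients are the moments of \<open>f\<close> times those of \<open>h\<close>.\<close>

lemma holomorphic_hilbert_integral:
  assumes f: "continuous_on (ball 0 1) f" and "\<alpha> < 1" "0 \<le> A"
    and A: "\<And>z. z \<in> ball 0 1 \<Longrightarrow> cmod (f z) \<le> A * (1 - cmod z) powr (-\<alpha>)"
  shows "hilbert_integral h f holomorphic_on ball 0 1"
proof -
  let ?F = "\<lambda>t. indicator {0..<1} t *\<^sub>R f (complex_of_real t)"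
  let ?m = "\<lambda>n. LINT t|lborel. ?F t * complex_of_real t ^ n"
  have int: "integrable lborel ?F"
    using set_integrable_radial[OF f \<open>\<alpha> < 1\<close> A] by (simp add: set_integrable_def)
  \<comment> \<open>The factor \<open>w - 0\<close> is the shape in which
    \<open>power_series_holomorphic\<close> expects the centre.\<close>
  have "(\<lambda>n. of_real (c n) * ?m n * (w - 0) ^ n) sums hilbert_integral h f w"
    if w: "w \<in> ball 0 1" for w
  proof -
    let ?G = "\<lambda>n t. ?F t * (of_real (c n) * (complex_of_real t * w) ^ n)"
    have w1: "cmod w < 1" using w by simp
    have sc: "summable (\<lambda>n. c n * cmod w ^ n)"
      using sums_summable[OF sums_real[of "cmod w"]] w1 by simp
    \<comment> \<open>This majorant is summable in n and integrable in t, which justifies exchanging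
      sum and integral.\<close>
    have G_le: "norm (?G n t) \<le> norm (?F t) * (c n * cmod w ^ n)" for n t
    proof (cases "t \<in> {0..<1}")
      case True
      then have "\<bar>t\<bar> ^ n \<le> 1" by (intro power_le_one) auto
      then have "(c n * cmod w ^ n) * \<bar>t\<bar> ^ n \<le> c n * cmod w ^ n"
        using nonneg by (intro mult_left_le) auto
      then have "norm (?F t) * ((c n * cmod w ^ n) * \<bar>t\<bar> ^ n) \<le> norm (?F t) * (c n * cmod w ^ n)"
        by (intro mult_left_mono) auto
      then show ?thesis
        using nonneg by (simp add: norm_mult norm_power power_mult_distrib mult_ac)
    qed simp
    have intG: "integrable lborel (?G n)" for n
    proof (rule Bochner_Integration.integrable_bound)
      show "integrable lborel (\<lambda>t. norm (?F t) * (c n * cmod w ^ n))"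
        using int by (intro integrable_mult_left integrable_norm)
      show "?G n \<in> borel_measurable lborel"
        using borel_measurable_integrable[OF int] by measurable
      show "AE t in lborel. norm (?G n t) \<le> norm (norm (?F t) * (c n * cmod w ^ n))"
        using G_le nonneg by (intro AE_I2) (simp add: abs_mult del: norm_scaleR)
    qed
    have "(\<lambda>n. integral\<^sup>L lborel (?G n)) sums (\<integral>t. (\<Sum>n. ?G n t) \<partial>lborel)"
    proof (rule sums_integral[OF intG])
      show "AE t in lborel. summable (\<lambda>n. norm (?G n t))"
        by (intro AE_I2 summable_comparison_test'[OF summable_mult[OF sc]]) (use G_le in auto)
      show "summable (\<lambda>n. \<integral>t. norm (?G n t) \<partial>lborel)"
      proof (rule summable_comparison_test'[OF summable_mult[OF sc]])
        fix n
        have "(\<integral>t. norm (?G n t) \<partial>lborel) \<le> (\<integral>t. norm (?F t) * (c n * cmod w ^ n) \<partial>lborel)"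
          using int intG G_le by (intro integral_mono integrable_norm integrable_mult_left)
        then show "norm (\<integral>t. norm (?G n t) \<partial>lborel)
            \<le> (\<integral>t. norm (?F t) \<partial>lborel) * (c n * cmod w ^ n)"
          by simp
      qed
    qed
    moreover have "(\<Sum>n. ?G n t) = indicator {0..<1} t *\<^sub>R (f (complex_of_real t) * h (complex_of_real t * w))" for t
    proof (cases "t \<in> {0..<1}")
      case True
      have "cmod (of_real t * w) \<le> cmod w"
        using True by (auto simp: norm_mult intro: mult_left_le_one_le)
      then have "(\<lambda>n. complex_of_real (c n) * (of_real t * w) ^ n) sums h (of_real t * w)"
        using w1 by (intro sums) auto
      from sums_unique[OF sums_mult[OF this, of "f (of_real t)"]] True show ?thesis by simp
    qed simp
    moreover have "integral\<^sup>L lborel (?G n) = of_real (c n) * ?m n * (w - 0) ^ n" for n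
    proof -
      have "?G n = (\<lambda>t. (of_real (c n) * w ^ n) * (?F t * complex_of_real t ^ n))"
        by (simp add: power_mult_distrib mult_ac fun_eq_iff)
      then have "integral\<^sup>L lborel (?G n) = (of_real (c n) * w ^ n) * ?m n"
        by (simp only: integral_mult_right_zero)
      then show ?thesis by (simp add: mult_ac)
    qed
    ultimately show ?thesis
      by (simp only: hilbert_integral_def set_lebesgue_integral_def)
  qed
  then show ?thesis by (rule power_series_holomorphic)
qed

text \<open>The growth bounds dominate the integrand by A B times the Forelli-Rudin kernel at r =
  |z|, whose integral has order (1 - |z|)^(-\<beta>).\<close>

lemma cmod_hilbert_integral_le:
  assumes f: "continuous_on (ball 0 1) f" and "\<alpha> < 1" "0 < \<beta>" "0 \<le> A" "0 \<le> B"
    and A: "\<And>z. z \<in> ball 0 1 \<Longrightarrow> cmod (f z) \<le> A * (1 - cmod z) powr (-\<alpha>)"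
    and B: "\<And>r. r \<in> {0..<1} \<Longrightarrow> Re (h (of_real r)) \<le> B * (1 - r) powr (-(1 + \<beta> - \<alpha>))"
    and z: "z \<in> ball 0 1"
  shows "cmod (hilbert_integral h f z)
    \<le> B * (1 / (1 - \<alpha>) + 1 / \<beta>) * A * (1 - cmod z) powr (-\<beta>)"
proof -
  let ?k = "\<lambda>t. (1 - t) powr (-\<alpha>) * (1 - cmod z * t) powr (-(1 + \<beta> - \<alpha>))"
  have z1: "cmod z < 1" using z by simp
  have int: "set_integrable lborel {0..<1} (\<lambda>t. f (complex_of_real t) * h (complex_of_real t * z))"
    by (rule set_integrable_hilbert_integrand[OF f \<open>\<alpha> < 1\<close> \<open>0 \<le> A\<close> A z])
  have k: "set_integrable lborel {0..<1} ?k"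
    using assms z1 by (intro set_integral_forelli_rudin) auto
  have "cmod (hilbert_integral h f z)
      \<le> (LINT t:{0..<1}|lborel. norm (f (complex_of_real t) * h (complex_of_real t * z)))"
    unfolding hilbert_integral_def by (rule set_integral_norm_bound[OF int])
  also have "\<dots> \<le> (LINT t:{0..<1}|lborel. (A * B) * ?k t)"
  proof (rule set_integral_mono)
    fix t :: real assume t: "t \<in> {0..<1}"
    have tz: "t * cmod z \<le> cmod z" using t by (intro mult_left_le_one_le) auto
    have "cmod (h (of_real t * z)) \<le> Re (h (of_real (cmod (of_real t * z))))"
      using tz z1 t by (intro cmod_le_radial) (simp add: norm_mult)
    also have "\<dots> \<le> B * (1 - cmod (of_real t * z)) powr (-(1 + \<beta> - \<alpha>))"
      using tz z1 t by (intro B) (simp add: norm_mult)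
    also have "cmod (of_real t * z) = cmod z * t" using t by (simp add: norm_mult)
    finally have "cmod (f (of_real t)) * cmod (h (of_real t * z))
        \<le> (A * (1 - t) powr (-\<alpha>)) * (B * (1 - cmod z * t) powr (-(1 + \<beta> - \<alpha>)))"
      using A[of "of_real t"] t \<open>0 \<le> A\<close> by (intro mult_mono) auto
    then show "norm (f (of_real t) * h (of_real t * z)) \<le> (A * B) * ?k t"
      by (simp only: norm_mult mult_ac)
  qed (use int k in \<open>auto simp: set_integrable_norm\<close>)
  also have "\<dots> = (A * B) * (LINT t:{0..<1}|lborel. ?k t)" by (rule set_integral_mult_right)
  also have "\<dots> \<le> (A * B) * ((1 / (1 - \<alpha>) + 1 / \<beta>) * (1 - cmod z) powr (-\<beta>))"
    using assms z1 by (intro mult_left_mono set_integral_forelli_rudin) auto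
  finally show ?thesis by (simp only: mult_ac)
qed

end

section \<open>The test function and necessity of the growth bound\<close>

text \<open>The principal branch is analytic here because 1 - z has positive real part on the disc.
  On [0, 1) it is positive and equals the majorant (1 - t)^(-\<alpha>) exactly.\<close>

definition korenblum_extremal :: "real \<Rightarrow> complex \<Rightarrow> complex" where
  "korenblum_extremal \<alpha> z = (1 - z) powr (- complex_of_real \<alpha>)"

lemma holomorphic_korenblum_extremal: "korenblum_extremal \<alpha> holomorphic_on ball 0 1"
proof -
  have "1 - z \<notin> \<real>\<^sub>\<le>\<^sub>0" if "z \<in> ball 0 1" for z :: complex
  proof -
    have "Re z < 1" using that complex_Re_le_cmod[of z] by simp
    then show ?thesis by (auto simp: complex_nonpos_Reals_iff)
  qed
  then show ?thesis
    unfolding korenblum_extremal_def by (intro holomorphic_intros) auto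
qed

text \<open>Since |1 - z| \<ge> 1 - |z| and the exponent is negative. The factor \<open>1 *\<close>
  gives the bound the shape with constant \<open>A = 1\<close> that the integrability lemma
  takes.\<close>

lemma cmod_korenblum_extremal_le:
  assumes "0 < \<alpha>" "z \<in> ball 0 1"
  shows "cmod (korenblum_extremal \<alpha> z) \<le> 1 * (1 - cmod z) powr (-\<alpha>)"
proof -
  have "cmod (korenblum_extremal \<alpha> z) = cmod (1 - z) powr (-\<alpha>)"
    unfolding korenblum_extremal_def
    using norm_powr_real_powr'[of "- complex_of_real \<alpha>" "1 - z"] by simp
  also have "\<dots> \<le> (1 - cmod z) powr (-\<alpha>)"
    using assms norm_triangle_ineq2[of 1 z] by (intro powr_mono2') auto
  finally show ?thesis by simp
qed

lemma korenblum_extremal_of_real: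
  "t \<le> 1 \<Longrightarrow> korenblum_extremal \<alpha> (of_real t) = of_real ((1 - t) powr (-\<alpha>))"
  unfolding korenblum_extremal_def using powr_of_real[of "1 - t" "-\<alpha>"] by simp

lemma korenblum_extremal_in_korenblum_space:
  assumes "0 < \<alpha>"
  shows "korenblum_extremal \<alpha> \<in> korenblum_space \<alpha>"
  unfolding korenblum_space_def mem_Collect_eq korenblum_norm_finite_iff[OF assms]
  using holomorphic_korenblum_extremal cmod_korenblum_extremal_le[OF assms]
  by (intro conjI exI[of _ 1]) auto

context nonneg_power_series
begin

text \<open>The integrand is nonnegative, and on \<open>[\<rho>, 1)\<close> the factor \<open>h (t \<rho>)\<close> is at least \<open>h (\<rho>\<^sup>2)\<close>.\<close>

lemma hilbert_integral_extremal_ge: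
  assumes "0 < \<alpha>" "\<alpha> < 1" "0 \<le> \<rho>" "\<rho> < 1"
  shows "Re (h (of_real (\<rho>\<^sup>2))) * (1 - \<rho>) powr (1 - \<alpha>) / (1 - \<alpha>)
    \<le> cmod (hilbert_integral h (korenblum_extremal \<alpha>) (of_real \<rho>))"
proof -
  let ?k = "\<lambda>t. (1 - t) powr (-\<alpha>) * Re (h (of_real (t * \<rho>)))"
  let ?E = "\<lambda>t. korenblum_extremal \<alpha> (complex_of_real t) * h (complex_of_real t * of_real \<rho>)"
  have t\<rho>: "0 \<le> t * \<rho>" "t * \<rho> < 1" if "t \<in> {0..<1}" for t
    using that assms mult_left_le_one_le[of \<rho> t] by auto
  have eq: "?E t = complex_of_real (?k t)" if "t \<in> {0..<1}" for t
    using that korenblum_extremal_of_real[of t \<alpha>] real_valued[OF t\<rho>[OF that]] by simp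
  \<comment> \<open>The comparison below is between real integrals, so integrability is first
    obtained for the complex integrand and then transferred to \<open>?k\<close>.\<close>
  have "set_integrable lborel {0..<1} ?E"
    using assms by (intro set_integrable_hilbert_integrand[OF _ _ _ cmod_korenblum_extremal_le]
        holomorphic_on_imp_continuous_on holomorphic_korenblum_extremal) auto
  then have "set_integrable lborel {0..<1} (\<lambda>t. complex_of_real (?k t))"
    using eq by (subst (asm) set_integrable_cong[OF refl refl eq]) auto
  then have "complex_integrable lborel (\<lambda>t. complex_of_real (indicator {0..<1} t *\<^sub>R ?k t))"
    unfolding set_integrable_def
    by (rule Bochner_Integration.integrable_cong[THEN iffD1, rotated -1]) (auto simp: indicator_def)
  then have int: "integrable lborel (\<lambda>t. indicator {0..<1} t *\<^sub>R ?k t)"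
    by (simp only: complex_of_real_integrable_eq)
  have "Re (h (of_real (\<rho>\<^sup>2))) * (1 - \<rho>) powr (1 - \<alpha>) / (1 - \<alpha>)
      = Re (h (of_real (\<rho>\<^sup>2))) * (LINT t|lborel. indicator {\<rho>..<1} t *\<^sub>R (1 - t) powr (-\<alpha>))"
    using has_bochner_integral_one_minus_powr[of \<alpha> \<rho>] assms by (simp add: has_bochner_integral_iff)
  also have "\<dots> = (LINT t|lborel. Re (h (of_real (\<rho>\<^sup>2))) * (indicator {\<rho>..<1} t *\<^sub>R (1 - t) powr (-\<alpha>)))"
    by (rule integral_mult_right_zero[symmetric])
  also have "\<dots> \<le> (LINT t|lborel. indicator {0..<1} t *\<^sub>R ?k t)"
  proof (rule integral_mono)
    show "integrable lborel (\<lambda>t. Re (h (of_real (\<rho>\<^sup>2))) * (indicator {\<rho>..<1} t *\<^sub>R (1 - t) powr (-\<alpha>)))"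
      using has_bochner_integral_one_minus_powr[of \<alpha> \<rho>] assms
      by (intro integrable_mult_right) (simp add: has_bochner_integral_iff)
    fix t :: real
    show "Re (h (of_real (\<rho>\<^sup>2))) * (indicator {\<rho>..<1} t *\<^sub>R (1 - t) powr (-\<alpha>))
        \<le> indicator {0..<1} t *\<^sub>R ?k t"
    proof (cases "t \<in> {\<rho>..<1}")
      case True
      then have t: "t \<in> {0..<1}" using assms by auto
      have "Re (h (of_real (\<rho>\<^sup>2))) \<le> Re (h (of_real (t * \<rho>)))"
        using True assms t\<rho>[OF t] by (intro mono_real) (auto simp: power2_eq_square intro: mult_right_mono)
      then have "Re (h (of_real (\<rho>\<^sup>2))) * (1 - t) powr (-\<alpha>) \<le> Re (h (of_real (t * \<rho>))) * (1 - t) powr (-\<alpha>)"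
        by (intro mult_right_mono) auto
      then show ?thesis using True t by (simp add: mult.commute)
    next
      case False
      have "0 \<le> indicator {0..<1} t *\<^sub>R ?k t"
        using nonneg_real[OF t\<rho>, of t] by (cases "t \<in> {0..<1}") auto
      then show ?thesis using False by simp
    qed
  qed (fact int)
  also have "\<dots> = (LINT t:{0..<1}|lborel. ?k t)" by (simp only: set_lebesgue_integral_def)
  also have "\<dots> \<le> cmod (of_real (LINT t:{0..<1}|lborel. ?k t))" by simp
  also have "complex_of_real (LINT t:{0..<1}|lborel. ?k t)
      = (LINT t:{0..<1}|lborel. complex_of_real (?k t))"
    by (rule set_integral_complex_of_real[symmetric])
  also have "\<dots> = hilbert_integral h (korenblum_extremal \<alpha>) (of_real \<rho>)"
    unfolding hilbert_integral_def using eq by (intro set_lebesgue_integral_cong) auto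
  finally show ?thesis .
qed

text \<open>The lower bound at \<rho> = sqrt r involves h(\<rho>^2) = h(r). Comparing it with the
  upper bound gives h(r) \<le> B (1 - \<rho>)^(-(1 + \<beta> - \<alpha>)), and 1 - \<rho> \<ge> (1 -
  r)/2 yields the factor 2 to the power 1 + \<beta> - \<alpha>.\<close>

lemma radial_bound_of_extremal:
  assumes "0 < \<alpha>" "\<alpha> < 1" "0 < \<beta>" "0 \<le> B" "0 \<le> r" "r < 1"
    and B: "\<And>z. z \<in> ball 0 1 \<Longrightarrow>
      cmod (hilbert_integral h (korenblum_extremal \<alpha>) z) \<le> B * (1 - cmod z) powr (-\<beta>)"
  shows "Re (h (of_real r)) \<le> B * 2 powr (1 + \<beta> - \<alpha>) * (1 - r) powr (-(1 + \<beta> - \<alpha>))"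
proof -
  let ?\<gamma> = "1 + \<beta> - \<alpha>"
  define \<rho> where "\<rho> = sqrt r"
  have \<rho>: "0 \<le> \<rho>" "\<rho> < 1" "\<rho>\<^sup>2 = r" using assms by (auto simp: \<rho>_def)
  have H: "0 \<le> Re (h (of_real r))" using assms by (intro nonneg_real)
  \<comment> \<open>Dividing by 1 - \<alpha>, which lies in (0, 1), only increases a nonnegative
    quantity.\<close>
  have "Re (h (of_real r)) * (1 - \<rho>) powr (1 - \<alpha>) \<le> Re (h (of_real r)) * (1 - \<rho>) powr (1 - \<alpha>) / (1 - \<alpha>)"
    using H assms by (simp add: pos_le_divide_eq mult_left_le)
  also have "\<dots> \<le> B * (1 - cmod (of_real \<rho>)) powr (-\<beta>)"
    using hilbert_integral_extremal_ge[of \<alpha> \<rho>] B[of "of_real \<rho>"] \<rho> assms by auto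
  finally have "Re (h (of_real r)) * (1 - \<rho>) powr (1 - \<alpha>) \<le> B * (1 - \<rho>) powr (-\<beta>)"
    using \<rho> by simp
  then have "Re (h (of_real r)) * (1 - \<rho>) powr (1 - \<alpha>) * (1 - \<rho>) powr (\<alpha> - 1)
      \<le> B * (1 - \<rho>) powr (-\<beta>) * (1 - \<rho>) powr (\<alpha> - 1)"
    by (intro mult_right_mono) auto
  then have "Re (h (of_real r)) \<le> B * (1 - \<rho>) powr (-?\<gamma>)"
    using \<rho> by (simp add: mult.assoc powr_add[symmetric] algebra_simps)
  also have "\<dots> \<le> B * ((1 - r) / 2) powr (-?\<gamma>)"
  proof (intro mult_left_mono powr_mono2')
    have "1 - r = (1 + \<rho>) * (1 - \<rho>)" by (simp flip: \<rho>(3) add: power2_eq_square algebra_simps)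
    also have "\<dots> \<le> 2 * (1 - \<rho>)" using \<rho> by (intro mult_right_mono) auto
    finally show "(1 - r) / 2 \<le> 1 - \<rho>" by simp
  qed (use assms in auto)
  also have "((1 - r) / 2) powr (-?\<gamma>) = 2 powr ?\<gamma> * (1 - r) powr (-?\<gamma>)"
    using assms powr_divide[of "1 - r" 2 "-?\<gamma>"] powr_minus_divide[of 2 ?\<gamma>] by simp
  finally show ?thesis by (simp only: mult.assoc)
qed

lemma bounded_hilbert_integral_iff:
  assumes "0 < \<alpha>" "\<alpha> < 1" "0 < \<beta>"
  shows "bounded_korenblum_operator \<alpha> \<beta> (hilbert_integral h) \<longleftrightarrow>
    (\<exists>B\<ge>0. \<forall>r\<in>{0..<1}. Re (h (of_real r)) \<le> B * (1 - r) powr (-(1 + \<beta> - \<alpha>)))"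
proof
  assume "bounded_korenblum_operator \<alpha> \<beta> (hilbert_integral h)"
  then have "hilbert_integral h (korenblum_extremal \<alpha>) \<in> korenblum_space \<beta>"
    using korenblum_extremal_in_korenblum_space assms by (simp add: bounded_korenblum_operator_def)
  then obtain B where "B \<ge> 0" "\<And>z. z \<in> ball 0 1 \<Longrightarrow>
      cmod (hilbert_integral h (korenblum_extremal \<alpha>) z) \<le> B * (1 - cmod z) powr (-\<beta>)"
    unfolding korenblum_space_def mem_Collect_eq korenblum_norm_finite_iff[OF \<open>0 < \<beta>\<close>] by blast
  then show "\<exists>B\<ge>0. \<forall>r\<in>{0..<1}. Re (h (of_real r)) \<le> B * (1 - r) powr (-(1 + \<beta> - \<alpha>))"
    using radial_bound_of_extremal[OF assms]
    by (intro exI[of _ "B * 2 powr (1 + \<beta> - \<alpha>)"]) auto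
next
  assume "\<exists>B\<ge>0. \<forall>r\<in>{0..<1}. Re (h (of_real r)) \<le> B * (1 - r) powr (-(1 + \<beta> - \<alpha>))"
  then obtain B where B: "B \<ge> 0"
    "\<And>r. r \<in> {0..<1} \<Longrightarrow> Re (h (of_real r)) \<le> B * (1 - r) powr (-(1 + \<beta> - \<alpha>))"
    by blast
  \<comment> \<open>The Forelli-Rudin constant times B; the operator norm is then at most 2^\<beta>
    K, the power of 2 coming from the weight 1 - |z|^2.\<close>
  define K where "K = B * (1 / (1 - \<alpha>) + 1 / \<beta>)"
  have K: "K \<ge> 0" using B assms by (simp add: K_def)
  have *: "hilbert_integral h f \<in> korenblum_space \<beta> \<and>
      korenblum_norm \<beta> (hilbert_integral h f) \<le> ennreal (2 powr \<beta> * K) * korenblum_norm \<alpha> f"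
    if f: "f \<in> korenblum_space \<alpha>" for f
  proof -
    define A where "A = enn2real (korenblum_norm \<alpha> f)"
    have holo: "f holomorphic_on ball 0 1" and fin: "korenblum_norm \<alpha> f < \<infinity>"
      using f by (auto simp: korenblum_space_def)
    have A: "A \<ge> 0" "ennreal A = korenblum_norm \<alpha> f"
      "\<And>z. z \<in> ball 0 1 \<Longrightarrow> cmod (f z) \<le> A * (1 - cmod z) powr (-\<alpha>)"
      using fin cmod_le_korenblum_norm[OF fin] assms by (auto simp: A_def)
    have cont: "continuous_on (ball 0 1) f" by (rule holomorphic_on_imp_continuous_on[OF holo])
    have "korenblum_norm \<beta> (hilbert_integral h f) \<le> ennreal (2 powr \<beta> * (K * A))"
    proof (rule korenblum_norm_le)
      show "cmod (hilbert_integral h f z) \<le> K * A * (1 - cmod z) powr (-\<beta>)" if "z \<in> ball 0 1" for z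
        unfolding K_def
        by (rule cmod_hilbert_integral_le[OF cont \<open>\<alpha> < 1\<close> \<open>0 < \<beta>\<close> A(1) B(1) A(3) B(2) that])
    qed (use assms K A in auto)
    also have "\<dots> = ennreal (2 powr \<beta> * K) * korenblum_norm \<alpha> f"
      using K A(1) unfolding A(2)[symmetric] by (subst ennreal_mult[symmetric]) (auto simp: mult.assoc)
    finally have le: "korenblum_norm \<beta> (hilbert_integral h f)
      \<le> ennreal (2 powr \<beta> * K) * korenblum_norm \<alpha> f" .
    also have "\<dots> < \<infinity>" using fin by (simp add: ennreal_mult_less_top)
    finally show ?thesis
      using le holomorphic_hilbert_integral[OF cont \<open>\<alpha> < 1\<close> A(1,3)]
      by (simp add: korenblum_space_def)
  qed
  then show "bounded_korenblum_operator \<alpha> \<beta> (hilbert_integral h)"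
    unfolding bounded_korenblum_operator_def by blast
qed

end

section \<open>Passage from g to its derivative and conclusion\<close>

lemma sums_deriv_power_series:
  fixes a :: "nat \<Rightarrow> complex"
  assumes g: "\<And>z. z \<in> ball 0 1 \<Longrightarrow> (\<lambda>n. a n * z ^ n) sums g z" and z: "z \<in> ball 0 1"
  shows "(\<lambda>n. diffs a n * z ^ n) sums deriv g z"
proof -
  have summ: "summable (\<lambda>n. a n * w ^ n)" if "cmod w < 1" for w
    using sums_summable[OF g] that by simp
  have "((\<lambda>z. \<Sum>n. a n * z ^ n) has_field_derivative (\<Sum>n. diffs a n * z ^ n)) (at z)"
    using z by (intro termdiffs_strong'[of 1] summ) auto
  \<comment> \<open>\<open>g\<close> agrees with its series only inside the disc, so the derivative
    is transferred along this open set.\<close>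
  then have "(g has_field_derivative (\<Sum>n. diffs a n * z ^ n)) (at z)"
    by (rule has_field_derivative_transform_within_open[OF _ open_ball z]) (simp add: sums_unique[OF g])
  then have "deriv g z = (\<Sum>n. diffs a n * z ^ n)" by (rule DERIV_imp_deriv)
  moreover have "summable (\<lambda>n. diffs a n * z ^ n)"
    using z by (intro termdiff_converges[of _ 1] summ) auto
  ultimately show ?thesis by (simp add: summable_sums)
qed

theorem theorem4p10:
  fixes g :: "complex \<Rightarrow> complex" and b :: "nat \<Rightarrow> real" and \<alpha> \<beta> :: real
  assumes "g holomorphic_on ball 0 1"
    and "\<And>z. z \<in> ball 0 1 \<Longrightarrow> (\<lambda>n. complex_of_real (b n) * z ^ n) sums g z"
    and "\<And>n. b n \<ge> 0"
    and "0 < \<alpha>" and "\<alpha> < 1" and "\<beta> > 0"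
  shows "(bounded_korenblum_operator \<alpha> \<beta> (generalized_hilbert g) \<longleftrightarrow>
            g \<in> bloch_space (1 + \<beta> - \<alpha>)) \<and>
         (g \<in> bloch_space (1 + \<beta> - \<alpha>) \<longleftrightarrow>
            (\<lambda>N. \<Sum>n=1..N. real n * b n) \<in> O(\<lambda>N. real N powr (1 + \<beta> - \<alpha>)))"
proof -
  interpret nonneg_power_series "\<lambda>n. real (Suc n) * b (Suc n)" "deriv g"
  proof
    fix z :: complex assume "z \<in> ball 0 1"
    from sums_deriv_power_series[OF assms(2) this]
    show "(\<lambda>n. complex_of_real (real (Suc n) * b (Suc n)) * z ^ n) sums deriv g z"
      by (simp add: diffs_def)
  qed (use assms(3) in simp)
  have \<gamma>: "0 < 1 + \<beta> - \<alpha>" using assms by simp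
  have "generalized_hilbert g = hilbert_integral (deriv g)"
    by (simp add: fun_eq_iff generalized_hilbert_def hilbert_integral_def)
  \<comment> \<open>The index shift matches the sum up to N with exactly the first N coefficients of
    g'.\<close>
  moreover have "(\<lambda>N. \<Sum>n=1..N. real n * b n) = (\<lambda>N. \<Sum>n<N. real (Suc n) * b (Suc n))"
    by (simp only: One_nat_def sum.atLeast1_atMost_eq)
  ultimately show ?thesis
    using bounded_hilbert_integral_iff[OF assms(4-6)] radial_iff_partial_sums[OF \<gamma>]
      korenblum_norm_finite_iff_radial[OF \<gamma>] bloch_space_iff_korenblum_norm_deriv[OF assms(1)]
    by simp
qed

end
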